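(* Abelian groups (not necessarily finitely generated) have uniform twin-width $2$.
   Context: For totally ordered sets $X,Y$, an $X\times Y$ matrix is a map $M:X\times Y\to\{0,1\}$. If $M$ is finite, a division of $M$ is a pair $(\mathcal X,\mathcal Y)$ of partitions of $X$ and $Y$ into intervals; the quotient $M/(\mathcal X,\mathcal Y)$ is the $\mathcal X\times\mathcal Y$ matrix with entry $1$ at $(X_i,Y_j)$ iff $M$ has a $1$-entry in $X_i\times Y_j$. A division sequence of $M$ is a sequence of divisions starting with the division into singletons, ending with $(\{X\},\{Y\})$, each obtained from the previous one by merging two (consecutive) parts of $\mathcal X$ or two of $\mathcal Y$. Its width is the maximum number of $1$-entries in a row or column of a quotient matrix along the sequence. The strict twin-width $\mathrm{stww}(M)$ is the minimum width of a division sequence; for infinite $M$ it is the supremum over finite submatrices. For a group $G$, a total order $<$ on $G$ and $g\in G$, let $M_g^<$ be the $(G,<)\times(G,<)$ matrix with $M_g^<(x,y)=1$ iff $xg=y$. The uniform twin-width of $G$ is $\mathrm{utww}(G)=\min_{<}\ \sup_{g\in G}\mathrm{stww}(M_g^<)\in\mathbb N\cup\{\infty\}$, the minimum being over all total orders $<$ on $G$.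
   Formalization: Equality with 2 is stated for nontrivial abelian groups only, with the bound at most 2 for all abelian groups, since the trivial group has uniform twin-width 1 (its only matrix is 1×1 with entry 1). *)

theory Defs
  imports
    "HOL-Algebra.Group"
    "HOL-Library.Disjoint_Sets"
    "HOL-Library.Extended_Nat"
begin

(* A matrix is given by finite or infinite index sets X and Y, reflexive linear orders r on X and
   s on Y, and its entries M :: 'a => 'b => bool, where True is the entry 1. A submatrix is obtained
   by shrinking X and Y only: every notion below looks at r and s only inside the current index
   sets, so the orders need not be restricted. *)

definition interval_in :: "'a set \<Rightarrow> 'a rel \<Rightarrow> 'a set \<Rightarrow> bool" where
  "interval_in X r I \<longleftrightarrow>
     I \<subseteq> X \<and> (\<forall>x\<in>I. \<forall>z\<in>I. \<forall>y\<in>X. (x, y) \<in> r \<and> (y, z) \<in> r \<longrightarrow> y \<in> I)"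

definition interval_partition :: "'a set \<Rightarrow> 'a rel \<Rightarrow> 'a set set \<Rightarrow> bool" where
  "interval_partition X r P \<longleftrightarrow> partition_on X P \<and> (\<forall>I\<in>P. interval_in X r I)"

definition is_division ::
  "'a set \<Rightarrow> 'a rel \<Rightarrow> 'b set \<Rightarrow> 'b rel \<Rightarrow> 'a set set \<times> 'b set set \<Rightarrow> bool" where
  "is_division X r Y s D \<longleftrightarrow> interval_partition X r (fst D) \<and> interval_partition Y s (snd D)"

definition quotient_entry :: "('a \<Rightarrow> 'b \<Rightarrow> bool) \<Rightarrow> 'a set \<Rightarrow> 'b set \<Rightarrow> bool" where
  "quotient_entry M A B \<longleftrightarrow> (\<exists>x\<in>A. \<exists>y\<in>B. M x y)"

definition merge :: "'a set set \<Rightarrow> 'a set set \<Rightarrow> bool" where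
  "merge P P' \<longleftrightarrow> (\<exists>A\<in>P. \<exists>B\<in>P. A \<noteq> B \<and> P' = insert (A \<union> B) (P - {A, B}))"

definition division_step :: "'a set set \<times> 'b set set \<Rightarrow> 'a set set \<times> 'b set set \<Rightarrow> bool" where
  "division_step D D' \<longleftrightarrow>
     merge (fst D) (fst D') \<and> snd D' = snd D \<or>
     fst D' = fst D \<and> merge (snd D) (snd D')"

(* Merged parts are automatically consecutive, because every member of the sequence is required to
   be a division, so the union of the two parts is again an interval. *)
definition division_sequence ::
  "'a set \<Rightarrow> 'a rel \<Rightarrow> 'b set \<Rightarrow> 'b rel \<Rightarrow> ('a set set \<times> 'b set set) list \<Rightarrow> bool" where
  "division_sequence X r Y s Ds \<longleftrightarrow>
     Ds \<noteq> [] \<and>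
     (\<forall>D\<in>set Ds. is_division X r Y s D) \<and>
     hd Ds = ((\<lambda>x. {x}) ` X, (\<lambda>y. {y}) ` Y) \<and>
     last Ds = ({X}, {Y}) \<and>
     successively division_step Ds"

definition division_width :: "('a \<Rightarrow> 'b \<Rightarrow> bool) \<Rightarrow> 'a set set \<times> 'b set set \<Rightarrow> nat" where
  "division_width M D =
     Max ((\<lambda>A. card {B \<in> snd D. quotient_entry M A B}) ` fst D \<union>
          (\<lambda>B. card {A \<in> fst D. quotient_entry M A B}) ` snd D)"

definition sequence_width :: "('a \<Rightarrow> 'b \<Rightarrow> bool) \<Rightarrow> ('a set set \<times> 'b set set) list \<Rightarrow> nat" where
  "sequence_width M Ds = Max (division_width M ` set Ds)"

(* The infimum is a minimum: enat is well-ordered, and a division sequence exists whenever X and Y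
   are finite, nonempty and linearly ordered. *)
definition stww_fin ::
  "'a set \<Rightarrow> 'a rel \<Rightarrow> 'b set \<Rightarrow> 'b rel \<Rightarrow> ('a \<Rightarrow> 'b \<Rightarrow> bool) \<Rightarrow> enat" where
  "stww_fin X r Y s M = (INF Ds\<in>{Ds. division_sequence X r Y s Ds}. enat (sequence_width M Ds))"

(* Submatrices without rows or without columns have no division sequence and are left out of the
   supremum. *)
definition stww ::
  "'a set \<Rightarrow> 'a rel \<Rightarrow> 'b set \<Rightarrow> 'b rel \<Rightarrow> ('a \<Rightarrow> 'b \<Rightarrow> bool) \<Rightarrow> enat" where
  "stww X r Y s M =
     (if finite X \<and> finite Y then stww_fin X r Y s M
      else (SUP (X', Y')\<in>{(X', Y'). X' \<subseteq> X \<and> Y' \<subseteq> Y \<and> finite X' \<and> finite Y' \<and>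
                                    X' \<noteq> {} \<and> Y' \<noteq> {}}. stww_fin X' r Y' s M))"

definition translation_matrix :: "('a, 'c) monoid_scheme \<Rightarrow> 'a \<Rightarrow> 'a \<Rightarrow> 'a \<Rightarrow> bool" where
  "translation_matrix G g x y \<longleftrightarrow> x \<otimes>\<^bsub>G\<^esub> g = y"

(* The infimum is a minimum: enat is well-ordered, and every set carries a linear order. *)
definition utww :: "('a, 'c) monoid_scheme \<Rightarrow> enat" where
  "utww G = (INF r\<in>{r. linear_order_on (carrier G) r}.
               SUP g\<in>carrier G. stww (carrier G) r (carrier G) r (translation_matrix G g))"

end

(* Call a 0/1 matrix separable if it can be built from matrices with at most one row and one column
   by direct and skew sums. A separable matrix has strict twin-width at most 2: contract both blocks
   of a sum separately, each down to a single entry, and then merge the resulting 2 x 2 matrix.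

   By Zorn's lemma there is a maximal subgroup H of G with an order whose translation matrices, on
   finite sets of rows and columns, are all separable. If x lies outside H, order the elements h x^k
   of the subgroup generated by H and x lexicographically, first by k and then by h, with
   0 <= k < n if the quotient is cyclic of order n, and k in Z if it is infinite cyclic. A
   translation then acts on the exponents as a shift, cyclic in the first case, and a cyclic shift
   is the skew sum of two increasing blocks; between cosets it acts as a translation of H. So it is
   separable, and H = G by maximality.

   Conversely, the first merge in an identity matrix of size at least 2 creates a row or a column
   with two entries. *)

theory Submission
  imports Defs
begin

section \<open>Separable matrices\<close>

definition before :: "'a rel \<Rightarrow> 'a set \<Rightarrow> 'a set \<Rightarrow> bool" where
  "before r A B \<longleftrightarrow> (\<forall>a\<in>A. \<forall>b\<in>B. (a, b) \<in> r \<and> (b, a) \<notin> r)"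

text \<open>Symmetric in \<open>A\<close> and \<open>B\<close>, so that one rule \<open>sum\<close> below covers direct and skew sums.\<close>

definition separated :: "'a rel \<Rightarrow> 'a set \<Rightarrow> 'a set \<Rightarrow> bool" where
  "separated r A B \<longleftrightarrow> before r A B \<or> before r B A"

text \<open>Orders and entries stay fixed and only the index sets vary, so a block is a pair of
  sets. An atom may lack rows or columns; a sum with such an atom adds a zero row or column at one
  end.\<close>

inductive separable ::
  "'a rel \<Rightarrow> 'b rel \<Rightarrow> ('a \<Rightarrow> 'b \<Rightarrow> bool) \<Rightarrow> 'a set \<Rightarrow> 'b set \<Rightarrow> bool"
  for r s M where
  atom: "X \<subseteq> {x} \<Longrightarrow> Y \<subseteq> {y} \<Longrightarrow> separable r s M X Y"
| sum: "separable r s M X\<^sub>1 Y\<^sub>1 \<Longrightarrow> separable r s M X\<^sub>2 Y\<^sub>2 \<Longrightarrow>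
    separated r X\<^sub>1 X\<^sub>2 \<Longrightarrow> separated s Y\<^sub>1 Y\<^sub>2 \<Longrightarrow>
    (\<And>x y. x \<in> X\<^sub>1 \<Longrightarrow> y \<in> Y\<^sub>2 \<Longrightarrow> \<not> M x y) \<Longrightarrow>
    (\<And>x y. x \<in> X\<^sub>2 \<Longrightarrow> y \<in> Y\<^sub>1 \<Longrightarrow> \<not> M x y) \<Longrightarrow>
    separable r s M (X\<^sub>1 \<union> X\<^sub>2) (Y\<^sub>1 \<union> Y\<^sub>2)"

text \<open>Atoms map to atoms and sums to sums, since separation is a condition on the orders
  alone. Rows and columns have their own maps because a translation may carry one coset to
  another.\<close>

lemma separable_image:
  assumes "separable r s M X Y"
    and "\<And>x x'. x \<in> X \<Longrightarrow> x' \<in> X \<Longrightarrow> (f x, f x') \<in> r' \<longleftrightarrow> (x, x') \<in> r"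
    and "\<And>y y'. y \<in> Y \<Longrightarrow> y' \<in> Y \<Longrightarrow> (h y, h y') \<in> s' \<longleftrightarrow> (y, y') \<in> s"
    and "\<And>x y. x \<in> X \<Longrightarrow> y \<in> Y \<Longrightarrow> M' (f x) (h y) \<longleftrightarrow> M x y"
  shows "separable r' s' M' (f ` X) (h ` Y)"
  using assms
proof (induction rule: separable.induct)
  case (atom X x Y y)
  show ?case
    by (rule separable.atom[of _ "f x" _ "h y"]) (use atom in auto)
next
  case (sum X1 Y1 X2 Y2)
  have "separable r' s' M' (f ` X1 \<union> f ` X2) (h ` Y1 \<union> h ` Y2)"
  proof (rule separable.sum)
    show "separable r' s' M' (f ` X1) (h ` Y1)" by (rule sum.IH(1)) (use sum.prems in auto)
    show "separable r' s' M' (f ` X2) (h ` Y2)" by (rule sum.IH(2)) (use sum.prems in auto)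
    show "separated r' (f ` X1) (f ` X2)"
      using sum.hyps(3) sum.prems(1) by (auto simp: separated_def before_def)
    show "separated s' (h ` Y1) (h ` Y2)"
      using sum.hyps(4) sum.prems(2) by (auto simp: separated_def before_def)
  qed (use sum.hyps sum.prems(3) in auto)
  then show ?case by (simp add: image_Un)
qed

text \<open>Entries 1 occur only where the row level \<open>\<kappa>\<close> equals the column level
  \<open>\<mu>\<close>, and both orders sort by level. So the matrix is the direct sum of its
  fibres.\<close>

lemma separable_fibres:
  fixes \<kappa> :: "'a \<Rightarrow> 'k::linorder" and \<mu> :: "'b \<Rightarrow> 'k"
  assumes "finite X" "finite Y"
    and X: "\<And>x x'. x \<in> X \<Longrightarrow> x' \<in> X \<Longrightarrow> \<kappa> x < \<kappa> x' \<Longrightarrow> (x, x') \<in> r \<and> (x', x) \<notin> r"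
    and Y: "\<And>y y'. y \<in> Y \<Longrightarrow> y' \<in> Y \<Longrightarrow> \<mu> y < \<mu> y' \<Longrightarrow> (y, y') \<in> s \<and> (y', y) \<notin> s"
    and M: "\<And>x y. x \<in> X \<Longrightarrow> y \<in> Y \<Longrightarrow> M x y \<Longrightarrow> \<kappa> x = \<mu> y"
    and fibre: "\<And>i. separable r s M {x \<in> X. \<kappa> x = i} {y \<in> Y. \<mu> y = i}"
  shows "separable r s M X Y"
proof -
  \<comment> \<open>\<open>K\<close> collects the levels treated so far; they are added in
    increasing order.\<close>
  have "separable r s M {x \<in> X. \<kappa> x \<in> K} {y \<in> Y. \<mu> y \<in> K}" if "finite K" for K
    using that
  proof (induction K rule: finite_linorder_max_induct)
    case empty
    show ?case by (rule separable.atom[of _ undefined _ undefined]) auto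
  next
    case (insert k K)
    have "separable r s M ({x \<in> X. \<kappa> x \<in> K} \<union> {x \<in> X. \<kappa> x = k}) ({y \<in> Y. \<mu> y \<in> K} \<union> {y \<in> Y. \<mu> y = k})"
    proof (rule separable.sum[OF insert.IH fibre])
      show "separated r {x \<in> X. \<kappa> x \<in> K} {x \<in> X. \<kappa> x = k}"
        using X insert.hyps(2) by (auto simp: separated_def before_def)
      show "separated s {y \<in> Y. \<mu> y \<in> K} {y \<in> Y. \<mu> y = k}"
        using Y insert.hyps(2) by (auto simp: separated_def before_def)
    qed (use M insert.hyps(2) in auto)
    moreover have "{x \<in> X. \<kappa> x \<in> K} \<union> {x \<in> X. \<kappa> x = k} = {x \<in> X. \<kappa> x \<in> insert k K}"
      "{y \<in> Y. \<mu> y \<in> K} \<union> {y \<in> Y. \<mu> y = k} = {y \<in> Y. \<mu> y \<in> insert k K}" by auto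
    ultimately show ?case by simp
  qed
  moreover have "{x \<in> X. \<kappa> x \<in> \<kappa> ` X \<union> \<mu> ` Y} = X" "{y \<in> Y. \<mu> y \<in> \<kappa> ` X \<union> \<mu> ` Y} = Y" by auto
  moreover have "finite (\<kappa> ` X \<union> \<mu> ` Y)" using assms(1,2) by simp
  ultimately show ?thesis by metis
qed

section \<open>Contracting separable matrices\<close>

abbreviation singletons :: "'a set \<Rightarrow> 'a set set" where
  "singletons X \<equiv> (\<lambda>x. {x}) ` X"

text \<open>A width of at most 2 expressed without \<open>Max\<close>, so that it also makes sense
  for a block with neither rows nor columns, where \<open>Max\<close> would be applied to the empty
  set.\<close>

definition narrow ::
  "'a set \<Rightarrow> 'a rel \<Rightarrow> 'b set \<Rightarrow> 'b rel \<Rightarrow> ('a \<Rightarrow> 'b \<Rightarrow> bool) \<Rightarrow> 'a set set \<times> 'b set set \<Rightarrow> bool" where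
  "narrow X r Y s M D \<longleftrightarrow> finite X \<and> finite Y \<and> is_division X r Y s D \<and>
     (\<forall>A\<in>fst D. card {B \<in> snd D. quotient_entry M A B} \<le> 2) \<and>
     (\<forall>B\<in>snd D. card {A \<in> fst D. quotient_entry M A B} \<le> 2)"

text \<open>Contractions become paths of this relation and can be joined by transitivity;
  \<open>narrow_steps_list\<close> turns them into lists.\<close>

definition narrow_step ::
  "'a set \<Rightarrow> 'a rel \<Rightarrow> 'b set \<Rightarrow> 'b rel \<Rightarrow> ('a \<Rightarrow> 'b \<Rightarrow> bool) \<Rightarrow>
    'a set set \<times> 'b set set \<Rightarrow> 'a set set \<times> 'b set set \<Rightarrow> bool" where
  "narrow_step X r Y s M D D' \<longleftrightarrow> division_step D D' \<and> narrow X r Y s M D \<and> narrow X r Y s M D'"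

lemma separated_sym: "separated r A B \<Longrightarrow> separated r B A"
  by (auto simp: separated_def)

lemma separated_disjoint: "separated r A B \<Longrightarrow> A \<inter> B = {}"
  by (auto simp: separated_def before_def)

text \<open>All of \<open>X'\<close> lies on one side of \<open>X\<close>, so none of it falls
  between two elements of \<open>I\<close>.\<close>

lemma interval_in_Un:
  assumes "interval_in X r I" "separated r X X'"
  shows "interval_in (X \<union> X') r I"
proof -
  have "y \<in> I" if "x \<in> I" "z \<in> I" "y \<in> X \<union> X'" "(x, y) \<in> r" "(y, z) \<in> r" for x y z
  proof -
    have "y \<notin> X'"
      using that assms unfolding interval_in_def separated_def before_def by blast
    then show ?thesis using that assms(1) unfolding interval_in_def by blast
  qed
  then show ?thesis using assms(1) unfolding interval_in_def by blast
qed

lemma interval_partition_Un: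
  assumes "interval_partition X r P" "interval_partition X' r P'" "separated r X X'"
  shows "interval_partition (X \<union> X') r (P \<union> P')"
proof -
  have "interval_in (X \<union> X') r I" if "I \<in> P" for I
    using that assms interval_in_Un unfolding interval_partition_def by blast
  moreover have "interval_in (X \<union> X') r I" if "I \<in> P'" for I
    using that assms interval_in_Un[of X' r I X, OF _ separated_sym]
    unfolding interval_partition_def Un_commute[of X] by blast
  moreover have "partition_on (X \<union> X') (P \<union> P')"
    using assms(1,2) separated_disjoint[OF assms(3)]
    unfolding interval_partition_def partition_on_def by (simp add: disjoint_union)
  ultimately show ?thesis unfolding interval_partition_def by blast
qed

lemma interval_partition_top: "interval_partition X r ({X} - {{}})"
  by (auto simp: interval_partition_def interval_in_def partition_on_def disjoint_def)

lemma finite_interval_partition: "finite X \<Longrightarrow> interval_partition X r P \<Longrightarrow> finite P"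
  unfolding interval_partition_def using finite_elements by blast

lemma narrow_if_card_le:
  assumes "finite X" "finite Y" "is_division X r Y s (P, Q)" "card P \<le> 2" "card Q \<le> 2"
  shows "narrow X r Y s M (P, Q)"
proof -
  have "finite P" "finite Q"
    using assms finite_interval_partition by (auto simp: is_division_def)
  then have "card {B \<in> Q. quotient_entry M A B} \<le> card Q"
    "card {A \<in> P. quotient_entry M A B} \<le> card P" for A B
    by (auto intro: card_mono)
  then have "card {B \<in> Q. quotient_entry M A B} \<le> 2" "card {A \<in> P. quotient_entry M A B} \<le> 2" for A B
    using assms(4,5) le_trans by blast+
  with assms show ?thesis by (simp add: narrow_def)
qed

text \<open>The off-diagonal blocks are zero, so a row or column of the quotient has the same number
  of entries 1 as in its own block.\<close>

lemma narrow_Un: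
  assumes D: "narrow X r Y s M (P, Q)" and E: "narrow X' r Y' s M (P', Q')"
    and "separated r X X'" "separated s Y Y'"
    and M: "\<And>x y. x \<in> X \<Longrightarrow> y \<in> Y' \<Longrightarrow> \<not> M x y" "\<And>x y. x \<in> X' \<Longrightarrow> y \<in> Y \<Longrightarrow> \<not> M x y"
  shows "narrow (X \<union> X') r (Y \<union> Y') s M (P \<union> P', Q \<union> Q')"
proof -
  have part: "interval_partition X r P" "interval_partition Y s Q"
    "interval_partition X' r P'" "interval_partition Y' s Q'"
    using D E by (auto simp: narrow_def is_division_def)
  have sub: "\<And>A. A \<in> P \<Longrightarrow> A \<subseteq> X" "\<And>A. A \<in> P' \<Longrightarrow> A \<subseteq> X'"
    "\<And>A. A \<in> Q \<Longrightarrow> A \<subseteq> Y" "\<And>A. A \<in> Q' \<Longrightarrow> A \<subseteq> Y'"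
    using part by (auto simp: interval_partition_def interval_in_def)
  have no\<^sub>1: "\<not> quotient_entry M A B" if "A \<in> P" "B \<in> Q'" for A B
    using sub(1)[OF that(1)] sub(4)[OF that(2)] M(1) unfolding quotient_entry_def by blast
  have no\<^sub>2: "\<not> quotient_entry M A B" if "A \<in> P'" "B \<in> Q" for A B
    using sub(2)[OF that(1)] sub(3)[OF that(2)] M(2) unfolding quotient_entry_def by blast
  have rows: "{B \<in> Q \<union> Q'. quotient_entry M A B} = {B \<in> Q. quotient_entry M A B}" if "A \<in> P" for A
    using that no\<^sub>1 by blast
  have rows': "{B \<in> Q \<union> Q'. quotient_entry M A B} = {B \<in> Q'. quotient_entry M A B}" if "A \<in> P'" for A
    using that no\<^sub>2 by blast
  have cols: "{A \<in> P \<union> P'. quotient_entry M A B} = {A \<in> P. quotient_entry M A B}" if "B \<in> Q" for B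
    using that no\<^sub>2 by blast
  have cols': "{A \<in> P \<union> P'. quotient_entry M A B} = {A \<in> P'. quotient_entry M A B}" if "B \<in> Q'" for B
    using that no\<^sub>1 by blast
  have "is_division (X \<union> X') r (Y \<union> Y') s (P \<union> P', Q \<union> Q')"
    using part assms(3,4) by (simp add: is_division_def interval_partition_Un)
  moreover have "card {B \<in> Q \<union> Q'. quotient_entry M A B} \<le> 2" if "A \<in> P \<union> P'" for A
    using that
  proof
    assume "A \<in> P"
    with D show ?thesis unfolding rows[OF \<open>A \<in> P\<close>] by (simp add: narrow_def)
  next
    assume "A \<in> P'"
    with E show ?thesis unfolding rows'[OF \<open>A \<in> P'\<close>] by (simp add: narrow_def)
  qed
  moreover have "card {A \<in> P \<union> P'. quotient_entry M A B} \<le> 2" if "B \<in> Q \<union> Q'" for B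
    using that
  proof
    assume "B \<in> Q"
    with D show ?thesis unfolding cols[OF \<open>B \<in> Q\<close>] by (simp add: narrow_def)
  next
    assume "B \<in> Q'"
    with E show ?thesis unfolding cols'[OF \<open>B \<in> Q'\<close>] by (simp add: narrow_def)
  qed
  moreover have "finite (X \<union> X')" "finite (Y \<union> Y')" using D E by (auto simp: narrow_def)
  ultimately show ?thesis unfolding narrow_def fst_conv snd_conv by blast
qed

text \<open>Parts in \<open>S\<close> are nonempty subsets of \<open>X'\<close>, which is disjoint
  from \<open>X\<close>. Hence removing \<open>A\<close> and \<open>B\<close> leaves
  \<open>S\<close> intact.\<close>

lemma merge_Un:
  assumes "merge P P'" "interval_partition X r P" "interval_partition X' r S" "separated r X X'"
  shows "merge (P \<union> S) (P' \<union> S)"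
proof -
  obtain A B where AB: "A \<in> P" "B \<in> P" "A \<noteq> B" "P' = insert (A \<union> B) (P - {A, B})"
    using assms(1) by (auto simp: merge_def)
  have "C \<notin> S" if "C \<in> P" for C
  proof
    assume "C \<in> S"
    then have "C \<subseteq> X \<inter> X'" "C \<noteq> {}"
      using that assms(2,3) by (auto simp: interval_partition_def interval_in_def partition_on_def)
    then show False using separated_disjoint[OF assms(4)] by simp
  qed
  then have "P' \<union> S = insert (A \<union> B) (P \<union> S - {A, B})" using AB by blast
  moreover have "A \<in> P \<union> S" "B \<in> P \<union> S" using AB by auto
  ultimately show ?thesis using AB(3) unfolding merge_def by blast
qed

text \<open>One block is contracted while the other is frozen at the division
  \<open>E\<close>.\<close>

lemma narrow_steps_Un:
  assumes "(narrow_step X r Y s M)\<^sup>*\<^sup>* D D'" and E: "narrow X' r Y' s M E"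
    and sep: "separated r X X'" "separated s Y Y'"
    and M: "\<And>x y. x \<in> X \<Longrightarrow> y \<in> Y' \<Longrightarrow> \<not> M x y" "\<And>x y. x \<in> X' \<Longrightarrow> y \<in> Y \<Longrightarrow> \<not> M x y"
  shows "(narrow_step (X \<union> X') r (Y \<union> Y') s M)\<^sup>*\<^sup>*
    (fst D \<union> fst E, snd D \<union> snd E) (fst D' \<union> fst E, snd D' \<union> snd E)"
  using assms(1)
proof (induction rule: rtranclp_induct)
  case base
  show ?case by simp
next
  case (step D1 D2)
  have n: "narrow X r Y s M D1" "narrow X r Y s M D2" and d: "division_step D1 D2"
    using step.hyps(2) by (auto simp: narrow_step_def)
  have "narrow (X \<union> X') r (Y \<union> Y') s M (fst D \<union> fst E, snd D \<union> snd E)"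
    if "narrow X r Y s M D" for D
    by (rule narrow_Un[OF _ _ sep M]) (use that E in simp_all)
  moreover have "division_step (fst D1 \<union> fst E, snd D1 \<union> snd E) (fst D2 \<union> fst E, snd D2 \<union> snd E)"
  proof -
    have part: "interval_partition X r (fst D1)" "interval_partition Y s (snd D1)"
      "interval_partition X' r (fst E)" "interval_partition Y' s (snd E)"
      using n(1) E by (simp_all add: narrow_def is_division_def)
    from d show ?thesis
      unfolding division_step_def fst_conv snd_conv
      using merge_Un[OF _ part(1,3) sep(1), of "fst D2"] merge_Un[OF _ part(2,4) sep(2), of "snd D2"]
      by metis
  qed
  ultimately show ?case
    using n by (intro rtranclp.rtrancl_into_rtrancl[OF step.IH]) (simp add: narrow_step_def)
qed

text \<open>The first alternative is the case of an empty set: it contributes no part, so there is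
  nothing to merge.\<close>

lemma merge_top:
  assumes "X \<inter> X' = {}"
  shows "({X} - {{}}) \<union> ({X'} - {{}}) = {X \<union> X'} - {{}} \<or>
    merge (({X} - {{}}) \<union> ({X'} - {{}})) ({X \<union> X'} - {{}})"
proof (cases "X = {} \<or> X' = {}")
  case False
  with assms have "X \<noteq> X'" by auto
  then have "merge {X, X'} {X \<union> X'}" by (auto simp: merge_def)
  moreover have "({X} - {{}}) \<union> ({X'} - {{}}) = {X, X'}" "{X \<union> X'} - {{}} = {X \<union> X'}"
    using False by auto
  ultimately show ?thesis by simp
qed auto

lemma card_top_Un: "card (({X} - {{}}) \<union> ({X'} - {{}})) \<le> 2"
proof -
  have "card (({X} - {{}}) \<union> ({X'} - {{}})) \<le> card {X, X'}" by (intro card_mono) auto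
  also have "\<dots> \<le> 2" by (simp add: card_insert_if)
  finally show ?thesis .
qed

lemma card_top: "card ({X} - {{}}) \<le> 2"
  using card_top_Un[of X X] by simp

text \<open>Blocks without rows or without columns occur, and \<open>{}\<close> is partitioned by \<open>{}\<close>, not by \<open>{{}}\<close>;
  hence the coarsest partition of \<open>X\<close> is written \<open>{X} - {{}}\<close>.\<close>

lemma separable_contraction:
  assumes "separable r s M X Y"
  shows "narrow X r Y s M (singletons X, singletons Y) \<and>
    (narrow_step X r Y s M)\<^sup>*\<^sup>* (singletons X, singletons Y) ({X} - {{}}, {Y} - {{}})"
  using assms
proof (induction rule: separable.induct)
  case (atom X x Y y)
  have eq: "singletons X = {X} - {{}}" "singletons Y = {Y} - {{}}" using atom by auto
  have "narrow X r Y s M ({X} - {{}}, {Y} - {{}})"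
    by (rule narrow_if_card_le)
      (use atom finite_subset in \<open>auto simp: is_division_def interval_partition_top card_top\<close>)
  then show ?case by (simp add: eq)
next
  case (sum X1 Y1 X2 Y2)
  let ?X = "X1 \<union> X2" and ?Y = "Y1 \<union> Y2"
  let ?step = "(narrow_step ?X r ?Y s M)\<^sup>*\<^sup>*"
  let ?P = "({X1} - {{}}) \<union> ({X2} - {{}})" and ?Q = "({Y1} - {{}}) \<union> ({Y2} - {{}})"
  have fin: "finite X1" "finite X2" "finite Y1" "finite Y2"
    using sum.IH by (auto simp: narrow_def)
  have top1: "narrow X1 r Y1 s M ({X1} - {{}}, {Y1} - {{}})"
    using fin by (intro narrow_if_card_le) (auto simp: is_division_def interval_partition_top card_top)
  have start: "narrow ?X r ?Y s M (singletons X1 \<union> singletons X2, singletons Y1 \<union> singletons Y2)"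
    by (rule narrow_Un) (use sum in auto)
  \<comment> \<open>The first block shrinks beside the singletons of the second; then the second
    shrinks beside the contracted first.\<close>
  have "?step (singletons X1 \<union> singletons X2, singletons Y1 \<union> singletons Y2)
      (({X1} - {{}}) \<union> singletons X2, ({Y1} - {{}}) \<union> singletons Y2)"
    using narrow_steps_Un[OF conjunct2[OF sum.IH(1)] conjunct1[OF sum.IH(2)]] sum.hyps by simp
  also have "?step (({X1} - {{}}) \<union> singletons X2, ({Y1} - {{}}) \<union> singletons Y2) (?P, ?Q)"
    using narrow_steps_Un[OF conjunct2[OF sum.IH(2)] top1] sum.hyps by (simp add: Un_commute separated_sym)
  \<comment> \<open>At most two parts are left on each side, so the width cannot exceed 2. The row
    parts are merged first, then the column parts.\<close>
  also have "?step (?P, ?Q) ({?X} - {{}}, {?Y} - {{}})"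
  proof -
    have P: "interval_partition ?X r ?P" and Q: "interval_partition ?Y s ?Q"
      using sum.hyps by (auto intro!: interval_partition_Un simp: interval_partition_top)
    have n: "narrow ?X r ?Y s M (?P, ?Q)" "narrow ?X r ?Y s M ({?X} - {{}}, ?Q)"
      "narrow ?X r ?Y s M ({?X} - {{}}, {?Y} - {{}})"
      by (rule narrow_if_card_le,
          simp_all only: finite_Un fin is_division_def fst_conv snd_conv P Q interval_partition_top
            card_top card_top_Un simp_thms)+
    have "?step (?P, ?Q) ({?X} - {{}}, ?Q)"
      using merge_top[OF separated_disjoint[OF sum.hyps(3)]]
    proof
      assume "merge ?P ({?X} - {{}})"
      with n(1,2) have "narrow_step ?X r ?Y s M (?P, ?Q) ({?X} - {{}}, ?Q)"
        unfolding narrow_step_def division_step_def by simp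
      then show ?thesis by (rule r_into_rtranclp)
    qed (simp only: rtranclp.rtrancl_refl)
    also have "?step ({?X} - {{}}, ?Q) ({?X} - {{}}, {?Y} - {{}})"
      using merge_top[OF separated_disjoint[OF sum.hyps(4)]]
    proof
      assume "merge ?Q ({?Y} - {{}})"
      with n(2,3) have "narrow_step ?X r ?Y s M ({?X} - {{}}, ?Q) ({?X} - {{}}, {?Y} - {{}})"
        unfolding narrow_step_def division_step_def by simp
      then show ?thesis by (rule r_into_rtranclp)
    qed (simp only: rtranclp.rtrancl_refl)
    finally show ?thesis .
  qed
  finally show ?case using start by (simp add: image_Un)
qed

section \<open>From contraction paths to division sequences\<close>

lemma narrow_steps_list:
  assumes "(narrow_step X r Y s M)\<^sup>*\<^sup>* D D'" "narrow X r Y s M D"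
  shows "\<exists>Ds. Ds \<noteq> [] \<and> (\<forall>D\<in>set Ds. narrow X r Y s M D) \<and> hd Ds = D \<and> last Ds = D' \<and>
    successively division_step Ds"
  using assms
proof (induction rule: converse_rtranclp_induct)
  case base
  then show ?case by (intro exI[of _ "[D']"]) simp
next
  case (step D1 D2)
  then obtain Ds where Ds: "Ds \<noteq> []" "\<forall>D\<in>set Ds. narrow X r Y s M D" "hd Ds = D2" "last Ds = D'"
    "successively division_step Ds" by (auto simp: narrow_step_def)
  with step show ?case
    by (intro exI[of _ "D1 # Ds"]) (auto simp: narrow_step_def successively_Cons)
qed

lemma division_width_le_2:
  assumes "narrow X r Y s M D" "X \<noteq> {}"
  shows "division_width M D \<le> 2"
proof -
  have "fst D \<noteq> {}" "finite (fst D)" "finite (snd D)"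
    using assms finite_interval_partition
    by (auto simp: narrow_def is_division_def interval_partition_def partition_on_def)
  then show ?thesis
    using assms unfolding division_width_def narrow_def by (subst Max_le_iff) auto
qed

lemma stww_fin_separable_le_2:
  assumes "separable r s M X Y" "X \<noteq> {}" "Y \<noteq> {}"
  shows "stww_fin X r Y s M \<le> 2"
proof -
  have "{X} - {{}} = {X}" "{Y} - {{}} = {Y}" using assms(2,3) by auto
  with narrow_steps_list separable_contraction[OF assms(1)]
  obtain Ds where Ds: "Ds \<noteq> []" "\<forall>D\<in>set Ds. narrow X r Y s M D"
    "hd Ds = (singletons X, singletons Y)" "last Ds = ({X}, {Y})" "successively division_step Ds"
    by metis
  then have "division_sequence X r Y s Ds" by (simp add: division_sequence_def narrow_def)
  then have "stww_fin X r Y s M \<le> enat (sequence_width M Ds)"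
    unfolding stww_fin_def by (auto intro: INF_lower)
  also have "sequence_width M Ds \<le> 2"
    unfolding sequence_width_def
    using Ds(1) by (subst Max_le_iff) (use Ds(2) division_width_le_2[OF _ assms(2)] in blast)+
  then have "enat (sequence_width M Ds) \<le> 2" by (simp add: numeral_eq_enat)
  finally show ?thesis .
qed

section \<open>Orders with separable translations\<close>

text \<open>The relation alone records the subgroup, as \<open>Field r\<close>. Thus extending
  subgroup and order together is inclusion of relations, the form suited to Zorn's lemma.\<close>

definition separable_order :: "('a, 'c) monoid_scheme \<Rightarrow> 'a rel \<Rightarrow> bool" where
  "separable_order G r \<longleftrightarrow> subgroup (Field r) G \<and> linear_order_on (Field r) r \<and>
     (\<forall>g\<in>Field r. \<forall>X Y. finite X \<longrightarrow> finite Y \<longrightarrow> X \<subseteq> Field r \<longrightarrow> Y \<subseteq> Field r \<longrightarrow>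
        separable r r (translation_matrix G g) X Y)"

lemma (in group) subgroup_int_pow_closed:
  assumes "subgroup H G" "h \<in> H"
  shows "h [^] (k::int) \<in> H"
  using group.int_pow_closed[OF subgroup.subgroup_is_group[OF assms(1) is_group], of h k]
    int_pow_consistent[OF assms(1), of h k] assms(2) by simp

text \<open>These exponents form a subgroup of the integers, so they are the multiples of the least
  positive one, or of 0 if there is none.\<close>

lemma (in group) exponents_in_subgroup:
  assumes H: "subgroup H G" and x: "x \<in> carrier G"
  obtains n :: int where "n \<ge> 0" "\<And>k. x [^] k \<in> H \<longleftrightarrow> n dvd k"
proof -
  have mult: "x [^] (n * q) \<in> H" if "x [^] n \<in> H" for n q :: int
    using subgroup_int_pow_closed[OF H that, of q] x by (simp add: int_pow_pow)
  have diff: "x [^] (j - k) \<in> H" if "x [^] j \<in> H" "x [^] k \<in> H" for j k :: int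
    using that H x by (simp add: int_pow_diff subgroup.m_closed subgroup.m_inv_closed)
  show thesis
  proof (cases "\<exists>m::nat. m > 0 \<and> x [^] int m \<in> H")
    case True
    define m where "m = (LEAST m::nat. m > 0 \<and> x [^] int m \<in> H)"
    have m: "m > 0" "x [^] int m \<in> H"
      using LeastI_ex[OF True] unfolding m_def by auto
    have "int m dvd k" if "x [^] k \<in> H" for k
    proof (rule ccontr)
      assume "\<not> int m dvd k"
      then have "k mod int m \<noteq> 0" using mod_0_imp_dvd by blast
      then have pos: "k mod int m > 0" "k mod int m < int m"
        using m(1) pos_mod_sign[of "int m" k] pos_mod_bound[of "int m" k] by linarith+
      \<comment> \<open>The exponent is \<open>k mod int m\<close>, positive but smaller than the
        least positive one.\<close>
      have "x [^] (k - int m * (k div int m)) \<in> H" using diff that mult m(2) by blast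
      then have "x [^] int (nat (k mod int m)) \<in> H" using pos by (simp add: minus_mult_div_eq_mod)
      with pos have "m \<le> nat (k mod int m)" unfolding m_def by (intro Least_le) simp
      with pos show False by linarith
    qed
    then show thesis using that[of "int m"] mult[OF m(2)] by (auto elim!: dvdE)
  next
    case False
    have "k = 0" if "x [^] k \<in> H" for k :: int
    proof (rule ccontr)
      assume "k \<noteq> 0"
      have "x [^] (-k) \<in> H" using diff[of 0 k] that H by (simp add: subgroup.one_closed)
      with that have "x [^] int (nat \<bar>k\<bar>) \<in> H" by (cases "k > 0") auto
      moreover have "nat \<bar>k\<bar> > 0" using \<open>k \<noteq> 0\<close> by simp
      ultimately show False using False by blast
    qed
    then have "x [^] k \<in> H \<longleftrightarrow> 0 dvd k" for k :: int
      using H by (auto simp: subgroup.one_closed)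
    then show thesis by (intro that[of 0]) simp_all
  qed
qed

text \<open>By commutativity a translation acts separately on the power of \<open>x\<close> and on
  the factor in \<open>H\<close>. Elements of \<open>H\<close> have exponent 0 and are their own
  factor, so the lexicographic order extends \<open>r\<close>.\<close>

lemma (in comm_group) separable_order_extend:
  assumes r: "separable_order G r" and x: "x \<in> carrier G"
  shows "\<exists>r'. separable_order G r' \<and> r \<subseteq> r' \<and> x \<in> Field r'"
proof -
  define H where "H = Field r"
  have H: "subgroup H G" and lin: "linear_order_on H r"
    and sep: "\<And>g X Y. g \<in> H \<Longrightarrow> finite X \<Longrightarrow> finite Y \<Longrightarrow> X \<subseteq> H \<Longrightarrow> Y \<subseteq> H \<Longrightarrow>
      separable r r (translation_matrix G g) X Y"
    using r by (auto simp: separable_order_def H_def)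
  have HG: "H \<subseteq> carrier G" using H by (rule subgroup.subset)
  obtain n :: int where n0: "n \<ge> 0" and n: "\<And>k. x [^] k \<in> H \<longleftrightarrow> n dvd k"
    using exponents_in_subgroup[OF H x] by blast

  \<comment> \<open>\<open>\<delta> e k\<close> is the factor \<open>h\<close> in
    \<open>e = h x^k\<close>; it lies in \<open>H\<close> exactly when \<open>e\<close> lies in the
    coset \<open>H x^k\<close>.\<close>
  define \<delta> where "\<delta> e k = e \<otimes> x [^] (- k)" for e and k :: int
  have \<delta>_closed: "\<delta> e k \<in> carrier G" if "e \<in> carrier G" for e k
    using that x by (simp add: \<delta>_def)
  have \<delta>_mult: "\<delta> (e \<otimes> e') (k + k') = \<delta> e k \<otimes> \<delta> e' k'"
    if "e \<in> carrier G" "e' \<in> carrier G" for e e' k k'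
  proof -
    have "x [^] (- (k + k')) = x [^] (- k) \<otimes> x [^] (- k')"
      using x int_pow_mult[of x "- k" "- k'"] by simp
    then show ?thesis using that x by (simp add: \<delta>_def m_ac)
  qed
  have \<delta>_inv: "\<delta> (inv e) (- k) = inv (\<delta> e k)" if "e \<in> carrier G" for e k
    using that x by (simp add: \<delta>_def inv_mult int_pow_neg)
  have \<delta>_0: "\<delta> e 0 = e" if "e \<in> carrier G" for e
    using that by (simp add: \<delta>_def)
  have \<delta>_inj: "\<delta> e k = \<delta> e' k \<longleftrightarrow> e = e'" if "e \<in> carrier G" "e' \<in> carrier G" for e e' k
    using that x by (simp add: \<delta>_def)
  have \<delta>_back: "\<delta> e k \<otimes> x [^] k = e" if "e \<in> carrier G" for e k
    using that x by (simp add: \<delta>_def m_assoc int_pow_neg)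

  \<comment> \<open>The union of these cosets is the subgroup generated by \<open>H\<close> and
    \<open>x\<close>.\<close>
  define E where "E = {e \<in> carrier G. \<exists>k. \<delta> e k \<in> H}"
  have E_I: "e \<in> E" if "e \<in> carrier G" "\<delta> e k \<in> H" for e k using that by (auto simp: E_def)
  have EG: "e \<in> carrier G" if "e \<in> E" for e using that by (simp add: E_def)
  have E: "subgroup E G"
  proof (rule subgroupI)
    show "E \<subseteq> carrier G" by (auto simp: E_def)
    show "E \<noteq> {}"
      using E_I[of \<one> 0] \<delta>_0[of \<one>] subgroup.one_closed[OF H] by auto
  next
    fix e assume "e \<in> E"
    then obtain k where "e \<in> carrier G" "\<delta> e k \<in> H" by (auto simp: E_def)
    then show "inv e \<in> E"
      using \<delta>_inv[of e k] subgroup.m_inv_closed[OF H] by (intro E_I[of _ "- k"]) simp_all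
  next
    fix e e' assume "e \<in> E" "e' \<in> E"
    then obtain k k' where "e \<in> carrier G" "\<delta> e k \<in> H" "e' \<in> carrier G" "\<delta> e' k' \<in> H"
      by (auto simp: E_def)
    then show "e \<otimes> e' \<in> E"
      using \<delta>_mult[of e e' k k'] subgroup.m_closed[OF H] by (intro E_I[of _ "k + k'"]) simp_all
  qed

  \<comment> \<open>The case \<open>n = 0\<close> is the infinite cyclic quotient, where \<open>k mod 0 = k\<close>.\<close>
  define \<kappa> where "\<kappa> e = (SOME k. \<delta> e k \<in> H) mod n" for e
  \<comment> \<open>The exponents \<open>k\<close> with \<open>e\<close> in \<open>H x^k\<close>
    form one residue class modulo \<open>n\<close>, and \<open>\<kappa> e\<close> is its canonical
    representative, whichever exponent \<open>SOME\<close> picks.\<close>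
  have \<kappa>: "\<delta> e k \<in> H \<longleftrightarrow> k mod n = \<kappa> e" if "e \<in> E" for e k
  proof -
    define k\<^sub>0 where "k\<^sub>0 = (SOME k. \<delta> e k \<in> H)"
    have k0: "\<delta> e k\<^sub>0 \<in> H" using that unfolding E_def k\<^sub>0_def by (auto intro: someI)
    have e: "e \<in> carrier G" using that by (rule EG)
    have eq: "\<delta> e k = x [^] (k\<^sub>0 - k) \<otimes> \<delta> e k\<^sub>0"
    proof -
      have "x [^] (- k) = x [^] (k\<^sub>0 - k) \<otimes> x [^] (- k\<^sub>0)"
        using x int_pow_mult[of x "k\<^sub>0 - k" "- k\<^sub>0"] by simp
      then show ?thesis using e x by (simp add: \<delta>_def m_ac)
    qed
    have "\<delta> e k \<in> H \<longleftrightarrow> x [^] (k\<^sub>0 - k) \<in> H"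
    proof
      assume "\<delta> e k \<in> H"
      then have "\<delta> e k \<otimes> inv (\<delta> e k\<^sub>0) \<in> H"
        using k0 H by (simp add: subgroup.m_closed subgroup.m_inv_closed)
      then show "x [^] (k\<^sub>0 - k) \<in> H" unfolding eq using \<delta>_closed[OF e] x by (simp add: m_assoc)
    next
      assume "x [^] (k\<^sub>0 - k) \<in> H"
      then show "\<delta> e k \<in> H" unfolding eq using k0 subgroup.m_closed[OF H] by blast
    qed
    also have "\<dots> \<longleftrightarrow> k mod n = \<kappa> e"
      unfolding n \<kappa>_def k\<^sub>0_def[symmetric] mod_eq_dvd_iff by (simp add: dvd_diff_commute)
    finally show ?thesis .
  qed
  have \<kappa>_mod: "\<kappa> e mod n = \<kappa> e" for e by (simp add: \<kappa>_def)
  have \<kappa>_H: "\<delta> e (\<kappa> e) \<in> H" if "e \<in> E" for e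
    using \<kappa>[OF that] \<kappa>_mod by simp
  have \<kappa>_mult: "\<kappa> (e \<otimes> e') = (\<kappa> e + \<kappa> e') mod n" if "e \<in> E" "e' \<in> E" for e e'
  proof -
    have "\<delta> (e \<otimes> e') (\<kappa> e + \<kappa> e') \<in> H"
      using that EG \<delta>_mult \<kappa>_H subgroup.m_closed[OF H] by simp
    then show ?thesis using \<kappa> that subgroup.m_closed[OF E] by metis
  qed
  have HE: "e \<in> E \<and> \<kappa> e = 0" if "e \<in> H" for e
  proof -
    have "\<delta> e 0 \<in> H" using that HG \<delta>_0 by auto
    moreover from this have "e \<in> E" using that HG by (auto simp: E_def)
    ultimately show ?thesis using \<kappa>[of e 0] by simp
  qed

  \<comment> \<open>Factors are compared only when the exponents agree, so \<open>\<kappa> a\<close>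
    serves for both elements.\<close>
  define r' where "r' = {(a, b). a \<in> E \<and> b \<in> E \<and>
    (\<kappa> a < \<kappa> b \<or> \<kappa> a = \<kappa> b \<and> (\<delta> a (\<kappa> a), \<delta> b (\<kappa> a)) \<in> r)}"
  have refl_r: "refl_on H r" and trans: "trans r" and antisym: "antisym r" and total: "total_on H r"
    using lin by (simp_all add: order_on_defs)
  have refl': "(e, e) \<in> r'" if "e \<in> E" for e
    using that \<kappa>_H refl_onD[OF refl_r] by (simp add: r'_def)
  have Field: "Field r' = E"
    using refl' unfolding Field_def r'_def by blast
  have less: "(a, b) \<in> r' \<and> (b, a) \<notin> r'" if "a \<in> E" "b \<in> E" "\<kappa> a < \<kappa> b" for a b
    using that by (simp add: r'_def)
  have lin': "linear_order_on E r'"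
    unfolding order_on_defs
  proof (intro conjI)
    show "r' \<subseteq> E \<times> E" by (auto simp: r'_def)
    show "refl_on E r'" using refl' by (rule refl_onI)
    show "trans r'"
    proof (rule transI)
      fix a b c assume "(a, b) \<in> r'" "(b, c) \<in> r'"
      then show "(a, c) \<in> r'" using transD[OF trans] unfolding r'_def by auto
    qed
    show "antisym r'"
    proof (rule antisymI)
      fix a b assume "(a, b) \<in> r'" "(b, a) \<in> r'"
      then have ab: "a \<in> E" "b \<in> E" "\<kappa> a = \<kappa> b" "(\<delta> a (\<kappa> a), \<delta> b (\<kappa> a)) \<in> r" "(\<delta> b (\<kappa> a), \<delta> a (\<kappa> a)) \<in> r"
        unfolding r'_def by auto
      then have "\<delta> a (\<kappa> a) = \<delta> b (\<kappa> a)" using antisymD[OF antisym] by blast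
      then show "a = b" using ab(1,2) \<delta>_inj EG by blast
    qed
    show "total_on E r'"
    proof (rule total_onI)
      fix a b assume *: "a \<in> E" "b \<in> E" "a \<noteq> b"
      show "(a, b) \<in> r' \<or> (b, a) \<in> r'"
      proof (cases "\<kappa> a = \<kappa> b")
        case True
        then have "\<delta> a (\<kappa> a) \<noteq> \<delta> b (\<kappa> a)" "\<delta> a (\<kappa> a) \<in> H" "\<delta> b (\<kappa> a) \<in> H"
          using * \<delta>_inj EG \<kappa>_H[of a] \<kappa>_H[of b] by auto
        with True * show ?thesis using total unfolding total_on_def r'_def by auto
      qed (use * in \<open>auto simp: r'_def\<close>)
    qed
  qed

  \<comment> \<open>In terms of the factors, \<open>g\<close> takes the coset with exponent
    \<open>i\<close> to the one with exponent \<open>j\<close> as the translation of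
    \<open>H\<close> by \<open>\<delta> g (j - i)\<close>. Values that \<kappa> never takes give
    empty fibres.\<close>
  have fibre: "separable r' r' (translation_matrix G g) {e \<in> X. \<kappa> e = i} {e \<in> Y. \<kappa> e = j}"
    if g: "g \<in> E" and X: "finite X" "X \<subseteq> E" and Y: "finite Y" "Y \<subseteq> E"
      and ij: "(i + \<kappa> g) mod n = j mod n" for g X Y i j
  proof -
    define X' where "X' = {e \<in> X. \<kappa> e = i}"
    define Y' where "Y' = {e \<in> Y. \<kappa> e = j}"
    have "(j - i) mod n = \<kappa> g mod n"
      using mod_diff_cong[OF ij refl, of i] by simp
    then have a: "\<delta> g (j - i) \<in> H" using \<kappa>[OF g] \<kappa>_mod by simp
    have X': "e \<in> E" "e \<in> carrier G" "\<kappa> e = i" "\<delta> e i \<in> H" "\<delta> e i \<otimes> x [^] i = e" if "e \<in> X'" for e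
      using that X(2) EG \<kappa>_H[of e] \<delta>_back[of e i] by (auto simp: X'_def)
    have Y': "e \<in> E" "e \<in> carrier G" "\<kappa> e = j" "\<delta> e j \<in> H" "\<delta> e j \<otimes> x [^] j = e" if "e \<in> Y'" for e
      using that Y(2) EG \<kappa>_H[of e] \<delta>_back[of e j] by (auto simp: Y'_def)
    have "separable r r (translation_matrix G (\<delta> g (j - i))) ((\<lambda>e. \<delta> e i) ` X') ((\<lambda>e. \<delta> e j) ` Y')"
      by (rule sep[OF a]) (use X Y X'(4) Y'(4) in \<open>auto simp: X'_def Y'_def\<close>)
    then have "separable r' r' (translation_matrix G g)
      ((\<lambda>h. h \<otimes> x [^] i) ` (\<lambda>e. \<delta> e i) ` X') ((\<lambda>h. h \<otimes> x [^] j) ` (\<lambda>e. \<delta> e j) ` Y')"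
    proof (rule separable_image)
      fix h h' assume "h \<in> (\<lambda>e. \<delta> e i) ` X'" "h' \<in> (\<lambda>e. \<delta> e i) ` X'"
      then show "(h \<otimes> x [^] i, h' \<otimes> x [^] i) \<in> r' \<longleftrightarrow> (h, h') \<in> r"
        using X' by (auto simp: r'_def)
    next
      fix h h' assume "h \<in> (\<lambda>e. \<delta> e j) ` Y'" "h' \<in> (\<lambda>e. \<delta> e j) ` Y'"
      then show "(h \<otimes> x [^] j, h' \<otimes> x [^] j) \<in> r' \<longleftrightarrow> (h, h') \<in> r"
        using Y' by (auto simp: r'_def)
    next
      fix h h' assume "h \<in> (\<lambda>e. \<delta> e i) ` X'" "h' \<in> (\<lambda>e. \<delta> e j) ` Y'"
      then obtain e e' where e: "e \<in> X'" "h = \<delta> e i" and e': "e' \<in> Y'" "h' = \<delta> e' j" by auto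
      have "\<delta> e i \<otimes> \<delta> g (j - i) = \<delta> (e \<otimes> g) j"
        using \<delta>_mult[of e g i "j - i"] X'(2)[OF e(1)] EG[OF g] by simp
      then show "translation_matrix G g (h \<otimes> x [^] i) (h' \<otimes> x [^] j) \<longleftrightarrow>
          translation_matrix G (\<delta> g (j - i)) h h'"
        using e e' X'(2,5) Y'(2,5) EG[OF g] \<delta>_inj by (simp add: translation_matrix_def)
    qed
    moreover have "(\<lambda>h. h \<otimes> x [^] i) ` (\<lambda>e. \<delta> e i) ` X' = X'"
      "(\<lambda>h. h \<otimes> x [^] j) ` (\<lambda>e. \<delta> e j) ` Y' = Y'"
      using X'(5) Y'(5) by (simp_all add: image_image)
    ultimately show ?thesis by (simp add: X'_def Y'_def)
  qed

  \<comment> \<open>Where the exponent changes by a fixed integer \<open>d\<close>, the row level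
    \<open>\<kappa> e + d\<close> matches the column level \<kappa>. Allowing any \<open>d\<close>
    congruent to \<open>\<kappa> g\<close> includes \<open>\<kappa> g - n\<close>, for rows that
    wrap around.\<close>
  have block: "separable r' r' (translation_matrix G g) X Y"
    if g: "g \<in> E" and X: "finite X" "X \<subseteq> E" and Y: "finite Y" "Y \<subseteq> E"
      and d: "d mod n = \<kappa> g mod n"
      and M: "\<And>e. e \<in> X \<Longrightarrow> e \<otimes> g \<in> Y \<Longrightarrow> \<kappa> (e \<otimes> g) = \<kappa> e + d" for g X Y d
  proof (rule separable_fibres[where \<kappa> = "\<lambda>e. \<kappa> e + d" and \<mu> = \<kappa>])
    fix i
    have "(i - d + \<kappa> g) mod n = i mod n"
      using mod_add_cong[OF refl d[symmetric], of "i - d"] by simp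
    from fibre[OF g X Y this]
    show "separable r' r' (translation_matrix G g) {e \<in> X. \<kappa> e + d = i} {e \<in> Y. \<kappa> e = i}"
      by (simp add: eq_diff_eq)
  qed (use X(1) Y(1) less[OF subsetD[OF X(2)] subsetD[OF X(2)]] less[OF subsetD[OF Y(2)] subsetD[OF Y(2)]] M
      in \<open>auto simp: translation_matrix_def\<close>)

  have "separable r' r' (translation_matrix G g) X Y"
    if g: "g \<in> E" and X: "finite X" "X \<subseteq> E" and Y: "finite Y" "Y \<subseteq> E" for g X Y
  proof (cases "n = 0")
    case True
    \<comment> \<open>Reduction modulo 0 is the identity, so nothing wraps around and one block
      suffices.\<close>
    show ?thesis
      by (rule block[OF g X Y, of "\<kappa> g"]) (use True \<kappa>_mult g X in auto)
  next
    case False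
    with n0 have npos: "n > 0" by simp
    have range: "0 \<le> \<kappa> e" "\<kappa> e < n" for e
      using npos \<kappa>_mod[of e] by (metis pos_mod_sign, metis pos_mod_bound)
    \<comment> \<open>Translation by \<open>g\<close> wraps around exactly on \<open>X\<^sub>2\<close>.\<close>
    define X\<^sub>1 where "X\<^sub>1 = {e \<in> X. \<kappa> e + \<kappa> g < n}"
    define X\<^sub>2 where "X\<^sub>2 = {e \<in> X. n \<le> \<kappa> e + \<kappa> g}"
    \<comment> \<open>As \<open>0 \<le> \<kappa> e < n\<close>, images without wrapping have
      exponent at least \<open>\<kappa> g\<close>, and wrapped ones have a smaller exponent.\<close>
    define Y\<^sub>1 where "Y\<^sub>1 = {e \<in> Y. \<kappa> g \<le> \<kappa> e}"
    define Y\<^sub>2 where "Y\<^sub>2 = {e \<in> Y. \<kappa> e < \<kappa> g}"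
    have up: "\<kappa> (e \<otimes> g) = \<kappa> e + \<kappa> g" if "e \<in> X\<^sub>1" for e
      using that X g \<kappa>_mult[of e g] range[of e] range[of g] by (auto simp: X\<^sub>1_def)
    have down: "\<kappa> (e \<otimes> g) = \<kappa> e + (\<kappa> g - n)" if "e \<in> X\<^sub>2" for e
    proof -
      have "(\<kappa> e + \<kappa> g) mod n = (\<kappa> e + \<kappa> g - n) mod n" by simp
      also have "\<dots> = \<kappa> e + \<kappa> g - n"
        using that range[of e] range[of g] by (intro mod_pos_pos_trivial) (auto simp: X\<^sub>2_def)
      finally show ?thesis using that X g \<kappa>_mult[of e g] by (auto simp: X\<^sub>2_def)
    qed
    have "separable r' r' (translation_matrix G g) (X\<^sub>1 \<union> X\<^sub>2) (Y\<^sub>1 \<union> Y\<^sub>2)"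
    proof (rule separable.sum)
      show "separable r' r' (translation_matrix G g) X\<^sub>1 Y\<^sub>1"
        by (rule block[OF g, of _ _ "\<kappa> g"]) (use X Y up in \<open>auto simp: X\<^sub>1_def Y\<^sub>1_def\<close>)
      show "separable r' r' (translation_matrix G g) X\<^sub>2 Y\<^sub>2"
        by (rule block[OF g, of _ _ "\<kappa> g - n"]) (use X Y down in \<open>auto simp: X\<^sub>2_def Y\<^sub>2_def\<close>)
      show "separated r' X\<^sub>1 X\<^sub>2"
        unfolding separated_def before_def
        by (intro disjI1 ballI less) (use X in \<open>auto simp: X\<^sub>1_def X\<^sub>2_def\<close>)
      \<comment> \<open>The wrapped columns come first while the wrapped rows come last: this is the
        skew sum.\<close>
      show "separated r' Y\<^sub>1 Y\<^sub>2"
        unfolding separated_def before_def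
        by (intro disjI2 ballI less) (use Y in \<open>auto simp: Y\<^sub>1_def Y\<^sub>2_def\<close>)
    next
      fix a b assume "a \<in> X\<^sub>1" "b \<in> Y\<^sub>2"
      then show "\<not> translation_matrix G g a b"
        using up[of a] range[of a] by (auto simp: translation_matrix_def Y\<^sub>2_def)
    next
      fix a b assume "a \<in> X\<^sub>2" "b \<in> Y\<^sub>1"
      then show "\<not> translation_matrix G g a b"
        using down[of a] range[of a] by (auto simp: translation_matrix_def Y\<^sub>1_def)
    qed
    moreover have "X\<^sub>1 \<union> X\<^sub>2 = X" "Y\<^sub>1 \<union> Y\<^sub>2 = Y" by (auto simp: X\<^sub>1_def X\<^sub>2_def Y\<^sub>1_def Y\<^sub>2_def)
    ultimately show ?thesis by simp
  qed
  then have "separable_order G r'"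
    unfolding separable_order_def Field using E lin' by blast
  moreover have "r \<subseteq> r'"
  proof
    fix p assume "p \<in> r"
    then obtain a b where p: "p = (a, b)" "(a, b) \<in> r" "a \<in> H" "b \<in> H"
      by (cases p) (auto simp: H_def Field_def)
    with HE[of a] HE[of b] show "p \<in> r'" using \<delta>_0 EG by (auto simp: r'_def)
  qed
  moreover have "x \<in> E"
  proof -
    have "\<delta> x 1 = \<one>" using x by (simp add: \<delta>_def int_pow_neg)
    then have "\<delta> x 1 \<in> H" using subgroup.one_closed[OF H] by simp
    then show ?thesis using x unfolding E_def by blast
  qed
  ultimately show ?thesis using Field by blast
qed

section \<open>Chains and a maximal order\<close>

text \<open>Products and separability involve finitely many elements at a time, and these all lie in
  the field of a single member of the chain.\<close>

lemma separable_order_Union: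
  assumes "C \<noteq> {}" and C: "subset.chain (Collect (separable_order G)) C"
  shows "separable_order G (\<Union>C)"
proof -
  have mem: "subgroup (Field r) G" "linear_order_on (Field r) r"
    "\<And>g X Y. g \<in> Field r \<Longrightarrow> finite X \<Longrightarrow> finite Y \<Longrightarrow> X \<subseteq> Field r \<Longrightarrow> Y \<subseteq> Field r \<Longrightarrow>
      separable r r (translation_matrix G g) X Y" if "r \<in> C" for r
    using that C by (auto simp: subset_chain_def separable_order_def)
  have chain: "chain\<^sub>\<subseteq> C" using C by (auto simp: chain_subset_def subset_chain_def)
  have Field: "Field (\<Union>C) = \<Union>(Field ` C)" by (auto simp: Field_def)
  have "Field r \<subseteq> Field s \<or> Field s \<subseteq> Field r" if "r \<in> C" "s \<in> C" for r s
    using chain that mono_Field[of r s] mono_Field[of s r] unfolding chain_subset_def by blast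
  then have chain': "subset.chain UNIV (Field ` C)" by (simp add: subset_chain_def)
  have cover: "\<exists>r\<in>C. A \<subseteq> Field r" if "finite A" "A \<subseteq> Field (\<Union>C)" for A
    by (rule finite_subset_Union_chain[OF that(1) _ _ chain'])
      (use that(2) assms(1) in \<open>auto simp: Field\<close>)
  have lin: "linear_order_on (Field (\<Union>C)) (\<Union>C)"
    unfolding order_on_defs
  proof (intro conjI)
    show "\<Union>C \<subseteq> Field (\<Union>C) \<times> Field (\<Union>C)" by (auto simp: Field_def)
    show "refl_on (Field (\<Union>C)) (\<Union>C)"
      using mem(2) by (auto simp: Field order_on_defs refl_on_def)
    show "trans (\<Union>C)"
      by (rule chain_subset_trans_Union[OF chain]) (use mem(2) in \<open>simp add: order_on_defs\<close>)
    show "antisym (\<Union>C)"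
      by (rule chain_subset_antisym_Union[OF chain]) (use mem(2) in \<open>simp add: order_on_defs\<close>)
    show "Total (\<Union>C)"
      by (rule chain_subset_Total_Union[OF chain]) (use mem(2) in \<open>simp add: order_on_defs\<close>)
  qed
  have "subgroup (Field (\<Union>C)) G"
  proof
    show "Field (\<Union>C) \<subseteq> carrier G" using mem(1) subgroup.subset Field by blast
    show "\<one>\<^bsub>G\<^esub> \<in> Field (\<Union>C)" using assms(1) mem(1) subgroup.one_closed Field by blast
  next
    fix a b assume "a \<in> Field (\<Union>C)" "b \<in> Field (\<Union>C)"
    then obtain r where "r \<in> C" "{a, b} \<subseteq> Field r" using cover[of "{a, b}"] by auto
    then show "a \<otimes>\<^bsub>G\<^esub> b \<in> Field (\<Union>C)" using mem(1) subgroup.m_closed Field by fastforce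
  next
    fix a assume "a \<in> Field (\<Union>C)"
    then show "inv\<^bsub>G\<^esub> a \<in> Field (\<Union>C)" using mem(1) subgroup.m_inv_closed unfolding Field by fast
  qed
  moreover have "separable (\<Union>C) (\<Union>C) (translation_matrix G g) X Y"
    if gXY: "g \<in> Field (\<Union>C)" "finite X" "finite Y" "X \<subseteq> Field (\<Union>C)" "Y \<subseteq> Field (\<Union>C)" for g X Y
  proof -
    obtain r where r: "r \<in> C" "insert g (X \<union> Y) \<subseteq> Field r"
      using cover[of "insert g (X \<union> Y)"] gXY by auto
    \<comment> \<open>\<open>r\<close> is already total on its field, so a further pair there would
      violate antisymmetry of the union.\<close>
    have agree: "(a, b) \<in> \<Union>C \<longleftrightarrow> (a, b) \<in> r" if "a \<in> Field r" "b \<in> Field r" for a b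
    proof
      assume ab: "(a, b) \<in> \<Union>C"
      show "(a, b) \<in> r"
      proof (rule ccontr)
        assume not: "(a, b) \<notin> r"
        then have "a \<noteq> b" using mem(2)[OF r(1)] that unfolding order_on_defs refl_on_def by auto
        moreover from this not have "(b, a) \<in> \<Union>C"
          using mem(2)[OF r(1)] that r(1) unfolding order_on_defs total_on_def by blast
        ultimately show False using lin ab unfolding order_on_defs antisym_def by blast
      qed
    qed (use r(1) in blast)
    have "separable (\<Union>C) (\<Union>C) (translation_matrix G g) (id ` X) (id ` Y)"
      by (rule separable_image[OF mem(3)[OF r(1), of g X Y]])
        (use r gXY agree in \<open>auto simp: subset_iff simp del: Union_iff\<close>)
    then show ?thesis by simp
  qed
  ultimately show ?thesis using lin unfolding separable_order_def by blast
qed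

text \<open>Zorn's lemma applies, the trivial subgroup giving a first order. Extending a maximal
  \<open>r\<close> by any \<open>x\<close> returns \<open>r\<close>, so \<open>x\<close> was already
  in its field.\<close>

lemma (in comm_group) separable_order_exists: "\<exists>r. separable_order G r \<and> Field r = carrier G"
proof -
  have triv: "separable_order G {(\<one>, \<one>)}"
  proof -
    have "Field {(\<one>, \<one>)} = {\<one>}" by (auto simp: Field_def)
    then show ?thesis
      by (auto simp: separable_order_def order_on_defs refl_on_def trans_def antisym_def
          triv_subgroup intro: separable.atom)
  qed
  then have "Collect (separable_order G) \<noteq> {}" by blast
  from subset_Zorn_nonempty[OF this] separable_order_Union
  obtain r where r: "separable_order G r"
    and max: "\<And>r'. separable_order G r' \<Longrightarrow> r \<subseteq> r' \<Longrightarrow> r' = r" by (metis mem_Collect_eq)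
  have "x \<in> Field r" if "x \<in> carrier G" for x
    using separable_order_extend[OF r that] max by blast
  moreover have "Field r \<subseteq> carrier G"
    using r subgroup.subset unfolding separable_order_def by metis
  ultimately have "Field r = carrier G" by blast
  with r show ?thesis by (intro exI[of _ r] conjI)
qed

section \<open>The upper bound\<close>

lemma utww_le_2:
  assumes "comm_group G"
  shows "utww G \<le> 2"
proof -
  interpret comm_group G by fact
  obtain r where r: "separable_order G r" "Field r = carrier G"
    using separable_order_exists by (elim exE conjE)
  have "carrier G \<noteq> {}" by blast
  \<comment> \<open>For a finite group this is applied to the whole matrix, for an infinite one to
    each term of the supremum.\<close>
  have fin: "stww_fin X r Y r (translation_matrix G g) \<le> 2"
    if "g \<in> carrier G" "finite X" "finite Y" "X \<subseteq> carrier G" "Y \<subseteq> carrier G" "X \<noteq> {}" "Y \<noteq> {}" for g X Y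
    by (rule stww_fin_separable_le_2) (use r that in \<open>simp_all add: separable_order_def\<close>)
  have "stww (carrier G) r (carrier G) r (translation_matrix G g) \<le> 2" if "g \<in> carrier G" for g
  proof (cases "finite (carrier G)")
    case True
    with that \<open>carrier G \<noteq> {}\<close> show ?thesis by (simp add: stww_def fin)
  next
    case False
    with that show ?thesis by (auto simp: stww_def intro!: SUP_least fin)
  qed
  then have "(SUP g\<in>carrier G. stww (carrier G) r (carrier G) r (translation_matrix G g)) \<le> 2"
    by (rule SUP_least)
  moreover have "linear_order_on (carrier G) r" using r by (simp add: separable_order_def)
  ultimately show ?thesis unfolding utww_def by (intro INF_lower2[of r]) simp_all
qed

section \<open>The lower bound\<close>

text \<open>In an identity matrix the part \<open>{x, y}\<close> meets both \<open>{x}\<close> and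
  \<open>{y}\<close> on the other side, which still consists of singletons.\<close>

lemma division_width_merge_singletons:
  assumes "x \<in> X" "y \<in> X" "x \<noteq> y"
    and M: "\<And>a b. a \<in> X \<Longrightarrow> b \<in> X \<Longrightarrow> M a b \<longleftrightarrow> a = b"
    and D: "{x, y} \<in> fst D \<and> snd D = singletons X \<or> {x, y} \<in> snd D \<and> fst D = singletons X"
    and fin: "finite (fst D)" "finite (snd D)"
  shows "2 \<le> division_width M D"
proof -
  have two: "card {{x}, {y}} = 2" using assms(3) by simp
  have fin': "finite ((\<lambda>A. card {B \<in> snd D. quotient_entry M A B}) ` fst D \<union>
          (\<lambda>B. card {A \<in> fst D. quotient_entry M A B}) ` snd D)" using fin by simp
  from D show ?thesis
  proof
    assume *: "{x, y} \<in> fst D \<and> snd D = singletons X"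
    then have "{{x}, {y}} \<subseteq> {B \<in> snd D. quotient_entry M {x, y} B}"
      using assms(1,2) M by (auto simp: quotient_entry_def)
    then have "2 \<le> card {B \<in> snd D. quotient_entry M {x, y} B}"
      unfolding two[symmetric] using fin by (intro card_mono) auto
    also have "\<dots> \<le> division_width M D"
      unfolding division_width_def using * by (intro Max_ge[OF fin']) auto
    finally show ?thesis .
  next
    assume *: "{x, y} \<in> snd D \<and> fst D = singletons X"
    then have "{{x}, {y}} \<subseteq> {A \<in> fst D. quotient_entry M A {x, y}}"
      using assms(1,2) M by (auto simp: quotient_entry_def)
    then have "2 \<le> card {A \<in> fst D. quotient_entry M A {x, y}}"
      unfolding two[symmetric] using fin by (intro card_mono) auto
    also have "\<dots> \<le> division_width M D"
      unfolding division_width_def using * by (intro Max_ge[OF fin']) auto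
    finally show ?thesis .
  qed
qed

lemma merge_singletons:
  assumes "merge (singletons X) P"
  obtains x y where "x \<in> X" "y \<in> X" "x \<noteq> y" "{x, y} \<in> P"
  using assms by (auto simp: merge_def)

text \<open>With two distinct elements, the singletons are not yet the final division, so every
  division sequence has a second member, and that one already has width at least 2.\<close>

lemma stww_fin_identity_ge_2:
  assumes X: "finite X" "u \<in> X" "v \<in> X" "u \<noteq> v"
    and M: "\<And>a b. a \<in> X \<Longrightarrow> b \<in> X \<Longrightarrow> M a b \<longleftrightarrow> a = b"
  shows "2 \<le> stww_fin X r X s M"
proof -
  have "2 \<le> enat (sequence_width M Ds)" if Ds: "division_sequence X r X s Ds" for Ds
  proof -
    have "singletons X \<noteq> {X}" using X by auto
    with Ds obtain D Ds' where eq: "Ds = (singletons X, singletons X) # D # Ds'"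
      by (cases Ds; cases "tl Ds") (auto simp: division_sequence_def)
    with Ds have step: "division_step (singletons X, singletons X) D" and D: "is_division X r X s D"
      by (auto simp: division_sequence_def)
    have fin: "finite (fst D)" "finite (snd D)"
      using D X(1) finite_interval_partition by (auto simp: is_division_def)
    have "2 \<le> division_width M D"
      using step unfolding division_step_def fst_conv snd_conv
    proof (elim disjE conjE)
      assume "merge (singletons X) (fst D)" "snd D = singletons X"
      then show ?thesis
        using division_width_merge_singletons[OF _ _ _ M _ fin] by (elim merge_singletons) blast
    next
      assume "fst D = singletons X" "merge (singletons X) (snd D)"
      then show ?thesis
        using division_width_merge_singletons[OF _ _ _ M _ fin] by (elim merge_singletons) blast
    qed
    also have "\<dots> \<le> sequence_width M Ds" unfolding sequence_width_def eq by (intro Max_ge) auto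
    finally show ?thesis by (simp add: numeral_eq_enat)
  qed
  then show ?thesis unfolding stww_fin_def by (auto intro: INF_greatest)
qed

text \<open>Translation by \<open>\<one>\<close> gives the identity matrix under every order. If the
  group is infinite, the 2 x 2 submatrix on \<open>h\<close> and \<open>\<one>\<close>
  suffices.\<close>

lemma utww_ge_2:
  fixes G (structure)
  assumes "monoid G" "carrier G \<noteq> {\<one>}"
  shows "2 \<le> utww G"
proof -
  interpret monoid G by fact
  obtain h where h: "h \<in> carrier G" "h \<noteq> \<one>" using assms(2) by blast
  have M: "translation_matrix G \<one> a b \<longleftrightarrow> a = b" if "a \<in> carrier G" for a b
    using that by (simp add: translation_matrix_def)
  have "2 \<le> (SUP g\<in>carrier G. stww (carrier G) r (carrier G) r (translation_matrix G g))" for r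
  proof (rule SUP_upper2[of \<one>])
    show "2 \<le> stww (carrier G) r (carrier G) r (translation_matrix G \<one>)"
    proof (cases "finite (carrier G)")
      case True
      with h M show ?thesis
        unfolding stww_def by (auto intro: stww_fin_identity_ge_2[of _ h \<one>])
    next
      case False
      have "2 \<le> stww_fin {h, \<one>} r {h, \<one>} r (translation_matrix G \<one>)"
        by (rule stww_fin_identity_ge_2[of _ h \<one>]) (use h M in auto)
      with False h show ?thesis
        unfolding stww_def by (auto intro!: SUP_upper2[of "({h, \<one>}, {h, \<one>})"])
    qed
  qed simp
  then show ?thesis unfolding utww_def by (auto intro: INF_greatest)
qed

text \<open>The trivial group is set apart because its only translation matrix is a single entry 1,
  of strict twin-width 1.\<close>

theorem proposition6p4:
  fixes G :: "('a, 'c) monoid_scheme"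
  assumes "comm_group G"
  shows "utww G \<le> 2 \<and> (carrier G \<noteq> {\<one>\<^bsub>G\<^esub>} \<longrightarrow> utww G = 2)"
proof -
  interpret comm_group G by fact
  show ?thesis using utww_le_2[OF assms] utww_ge_2[OF is_monoid] by (auto intro: antisym)
qed

end
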